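(* Let $m$ be a square-free odd positive integer and let $p$ be a prime with $p>m$. Then $g(\Phi_{mp})=\varphi(m)$.
   Context: $\Phi_n$ denotes the $n$-th cyclotomic polynomial and $\varphi$ is Euler's totient function. For a nonzero polynomial $f=c_1x^{e_1}+\cdots+c_tx^{e_t}$ with $c_1,\dots,c_t\neq 0$ and $e_1<\cdots<e_t$, the maximum gap is $g(f)=\max_{1\le k<t}(e_{k+1}-e_k)$, the largest difference between consecutive exponents occurring in $f$. *)

theory Defs
  imports
    Complex_Main
    "HOL-Computational_Algebra.Computational_Algebra"
    "HOL-Number_Theory.Totient"
begin

text \<open>Viewed over the complex numbers; only the exponents that occur matter for the gap.\<close>
definition cyclotomic :: "nat \<Rightarrow> complex poly" where
  "cyclotomic n = (\<Prod>k\<in>totatives n. [:- cis (2 * pi * real k / real n), 1:])"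

definition exponents :: "'a::zero poly \<Rightarrow> nat set" where
  "exponents f = {e. coeff f e \<noteq> 0}"

text \<open>The gaps are the differences of consecutive exponents. The value of \<open>max_gap\<close> is
  unspecified for polynomials with fewer than two terms, where there are no gaps.\<close>
definition gaps :: "'a::zero poly \<Rightarrow> nat set" where
  "gaps f = {e' - e | e e'. e \<in> exponents f \<and> e' \<in> exponents f \<and> e < e' \<and>
                            exponents f \<inter> {e<..<e'} = {}}"

definition max_gap :: "'a::zero poly \<Rightarrow> nat" where
  "max_gap f = Max (gaps f)"

end

theory Submission
  imports Defs
begin

text \<open>
  Everything follows from \<open>\<Phi>\<^sub>m(x) \<Phi>\<^sub>m\<^sub>p(x) = \<Phi>\<^sub>m(x\<^sup>p)\<close>.
  If \<open>\<Phi>\<^sub>m\<^sub>p\<close> had \<open>\<phi>(m)\<close> consecutive zero coefficients at \<open>u, \<dots>, u + \<phi>(m) - 1\<close>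
  strictly between two exponents, let \<open>F\<close> be the part of \<open>\<Phi>\<^sub>m\<^sub>p\<close> below \<open>x\<^sup>u\<close>.
  As \<open>\<Phi>\<^sub>m\<close> has degree \<open>\<phi>(m)\<close>, the product \<open>\<Phi>\<^sub>m F\<close> is exactly the part of
  \<open>\<Phi>\<^sub>m(x\<^sup>p)\<close> of degree below \<open>u + \<phi>(m)\<close>, that is, \<open>T(x\<^sup>p)\<close> for a proper truncation \<open>T\<close> of
  \<open>\<Phi>\<^sub>m\<close>. Since \<open>p\<close>-th powers permute the primitive \<open>m\<close>-th roots of unity, \<open>T\<close> vanishes at
  all of them, although it is nonzero of degree less than \<open>\<phi>(m)\<close>.
  For the lower bound, write \<open>x\<^sup>m - 1 = \<Phi>\<^sub>m \<Psi>\<close>; then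
  \<open>(x\<^sup>m - 1) \<Phi>\<^sub>m\<^sub>p = \<Psi>(x) \<Phi>\<^sub>m(x\<^sup>p)\<close>, and below degree \<open>p > m\<close> the right-hand side is a
  constant multiple of \<open>\<Psi>\<close>, which has degree \<open>m - \<phi>(m)\<close>. So \<open>m - \<phi>(m)\<close> and \<open>m\<close> are
  consecutive exponents.
\<close>

section \<open>Polynomials\<close>

lemma degree_prod_linear:
  fixes A :: "'a::idom set"
  shows "degree (\<Prod>z\<in>A. [:- z, 1:]) = card A"
  by (subst degree_prod_eq_sum_degree) auto

lemma lead_coeff_prod_linear:
  fixes A :: "'a::idom set"
  shows "lead_coeff (\<Prod>z\<in>A. [:- z, 1:]) = 1"
  by (subst lead_coeff_prod) simp

text \<open>Two monic polynomials of degree \<open>card A\<close> that agree on \<open>A\<close>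
  coincide. This reduces both factorizations below to counting roots.\<close>

lemma monic_eq_prod_linear:
  fixes f :: "'a::idom poly"
  assumes "finite A" "lead_coeff f = 1" "degree f = card A" "\<And>z. z \<in> A \<Longrightarrow> poly f z = 0"
  shows "f = (\<Prod>z\<in>A. [:- z, 1:])"
proof (rule poly_eqI_degree_lead_coeff[where A = A and n = "card A"])
  show "coeff f (card A) = coeff (\<Prod>z\<in>A. [:- z, 1:]) (card A)"
    using assms lead_coeff_prod_linear[of A] by (simp add: degree_prod_linear)
  show "poly f z = poly (\<Prod>z\<in>A. [:- z, 1:]) z" if "z \<in> A" for z
    using that assms by (auto simp: poly_prod)
qed (use assms in \<open>auto simp: degree_prod_linear\<close>)

lemma coeff_pcompose_monom_power:
  fixes f :: "'a::comm_semiring_1 poly"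
  assumes "d > 0"
  shows "coeff (pcompose f (monom 1 d)) n = (if d dvd n then coeff f (n div d) else 0)"
proof (induction f arbitrary: n)
  case (pCons a f)
  show ?case
  proof (cases "n < d")
    case True
    then show ?thesis using assms
      by (auto simp: pcompose_pCons coeff_monom_mult coeff_pCons dvd_imp_le split: nat.splits)
  next
    case False
    then have "n div d = Suc ((n - d) div d)"
      using assms by (simp add: le_div_geq)
    moreover have "d dvd n \<longleftrightarrow> d dvd n - d"
      using False by (metis dvd_minus_self)
    ultimately show ?thesis
      using False assms pCons.IH[of "n - d"]
      by (auto simp: pcompose_pCons coeff_monom_mult coeff_pCons split: nat.splits)
  qed
qed simp

lemma poly_cutoff_pcompose_monom:
  fixes f :: "'a::comm_semiring_1 poly"
  assumes "d > 0" "n > 0"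
  shows "poly_cutoff n (pcompose f (monom 1 d)) =
    pcompose (poly_cutoff (Suc ((n - 1) div d)) f) (monom 1 d)"
proof (rule poly_eqI)
  fix k
  \<comment> \<open>Only multiples of \<open>d\<close> occur as exponents, and the last one below
    \<open>n\<close> is \<open>d * ((n - 1) div d)\<close>.\<close>
  have "k < n \<longleftrightarrow> k div d < Suc ((n - 1) div d)" if "d dvd k"
  proof -
    have "k < n \<longleftrightarrow> k \<le> n - 1"
      using assms by auto
    also have "\<dots> \<longleftrightarrow> k div d \<le> (n - 1) div d"
      using that assms by (simp add: less_eq_div_iff_mult_less_eq)
    finally show ?thesis by (simp only: less_Suc_eq_le)
  qed
  then show "coeff (poly_cutoff n (pcompose f (monom 1 d))) k =
    coeff (pcompose (poly_cutoff (Suc ((n - 1) div d)) f) (monom 1 d)) k"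
    using assms by (auto simp: coeff_pcompose_monom_power coeff_poly_cutoff)
qed

text \<open>A coefficient of \<open>f * g\<close> sees only the last \<open>d + 1\<close>
  coefficients of \<open>g\<close> up to its own index. Below \<open>u + d\<close> the gap hides the
  truncation; from \<open>u + d\<close> on, nothing of the truncated factor is reached.\<close>

lemma poly_cutoff_mult_gap:
  fixes f g :: "'a::comm_semiring_1 poly"
  assumes "degree f \<le> d" and gap: "\<And>k. u \<le> k \<Longrightarrow> k < u + d \<Longrightarrow> coeff g k = 0"
  shows "poly_cutoff (u + d) (f * g) = f * poly_cutoff u g"
proof (rule poly_eqI)
  fix n
  show "coeff (poly_cutoff (u + d) (f * g)) n = coeff (f * poly_cutoff u g) n"
  proof (cases "n < u + d")
    case True
    have "coeff g (n - i) = coeff (poly_cutoff u g) (n - i)" for i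
      using gap[of "n - i"] True by (auto simp: coeff_poly_cutoff)
    then show ?thesis
      using True by (simp add: coeff_poly_cutoff coeff_mult)
  next
    case False
    have "coeff f i * coeff (poly_cutoff u g) (n - i) = 0" for i
      using False assms(1) by (cases "i \<le> d") (auto simp: coeff_poly_cutoff coeff_eq_0)
    then show ?thesis
      using False by (simp add: coeff_poly_cutoff coeff_mult)
  qed
qed

section \<open>Primitive roots of unity and cyclotomic polynomials\<close>

text \<open>For \<open>n > 0\<close> these are the elements of order exactly \<open>n\<close>.
  Phrasing the order as an equivalence turns facts about powers into divisibility
  arithmetic.\<close>

definition primitive_roots :: "nat \<Rightarrow> complex set" where
  "primitive_roots n = {z. \<forall>k. z ^ k = 1 \<longleftrightarrow> n dvd k}"

lemma primitive_rootsD: "z \<in> primitive_roots n \<Longrightarrow> z ^ k = 1 \<longleftrightarrow> n dvd k"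
  by (simp add: primitive_roots_def)

lemma cis_eq_1_iff_dvd:
  assumes "n > 0"
  shows "cis (2 * pi * real k / real n) = 1 \<longleftrightarrow> n dvd k"
proof
  assume "cis (2 * pi * real k / real n) = 1"
  then have "cos (2 * pi * real k / real n) = 1"
    by (simp add: complex_eq_iff)
  then obtain j :: int where "2 * pi * real k / real n = of_int j * 2 * pi"
    by (subst (asm) cos_one_2pi_int) blast
  then have "real_of_int (int k) = real_of_int (j * int n)"
    using assms by (simp add: field_simps)
  then have "int k = j * int n"
    by (simp only: of_int_eq_iff)
  then show "n dvd k"
    by (metis dvd_triv_right int_dvd_int_iff)
next
  assume "n dvd k"
  then obtain j where "k = n * j" by blast
  then have "2 * pi * real k / real n = 2 * pi * real j"
    using assms by simp
  then show "cis (2 * pi * real k / real n) = 1"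
    using cis_multiple_2pi[of "real j"] by simp
qed

lemma bij_betw_primitive_roots:
  assumes "n > 0"
  shows "bij_betw (\<lambda>k. cis (2 * pi * real k / real n)) (totatives n) (primitive_roots n)"
    (is "bij_betw ?f _ _")
  unfolding bij_betw_def
proof
  have pow: "?f k ^ j = ?f (k * j)" for k j
    by (simp add: DeMoivre mult_ac)
  show "inj_on ?f (totatives n)"
  proof (rule linorder_inj_onI')
    fix k l
    assume kl: "k \<in> totatives n" "l \<in> totatives n" "k < l"
    show "?f k \<noteq> ?f l"
    proof
      assume "?f k = ?f l"
      then have "1 = ?f l / ?f k" by simp
      also have "\<dots> = ?f (l - k)"
        using kl by (simp add: cis_divide of_nat_diff diff_divide_distrib right_diff_distrib)
      finally have "n dvd l - k"
        using cis_eq_1_iff_dvd[OF assms, of "l - k"] by simp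
      then have "n \<le> l - k"
        using kl by (simp add: dvd_imp_le)
      with kl show False
        by (auto simp: totatives_def)
    qed
  qed
  show "?f ` totatives n = primitive_roots n"
  proof (intro subset_antisym subsetI)
    fix z assume "z \<in> ?f ` totatives n"
    then obtain k where k: "k \<in> totatives n" "z = ?f k" by blast
    then have "coprime n k"
      by (simp add: in_totatives_iff coprime_commute)
    then show "z \<in> primitive_roots n"
      using k cis_eq_1_iff_dvd[OF assms]
      by (simp add: primitive_roots_def pow coprime_dvd_mult_right_iff del: of_nat_mult)
  next
    fix z assume z: "z \<in> primitive_roots n"
    then have "z \<in> {z. z ^ n = 1}"
      by (simp add: primitive_rootsD)
    then obtain k where k: "k < n" "z = ?f k"
      using bij_betw_roots_unity[OF assms] unfolding bij_betw_def by blast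
    show "z \<in> ?f ` totatives n"
    \<comment> \<open>Totatives are positive, so the exponent 0 needs separate care: it arises only
      for \<open>n = 1\<close>, where the totative 1 gives the same root.\<close>
    proof (cases "k = 0")
      case True
      with k have "z ^ 1 = 1" by simp
      with z have "n = 1"
        using primitive_rootsD[OF z, of 1] by simp
      with k True show ?thesis by simp
    next
      case False
      define g where "g = gcd k n"
      \<comment> \<open>A common factor \<open>g\<close> of \<open>k\<close> and \<open>n\<close>
        would lower the order of \<open>z\<close> to a divisor of \<open>n div g\<close>.\<close>
      have "k * (n div g) = n * (k div g)"
        by (simp add: g_def mult.commute div_mult_swap)
      then have "z ^ (n div g) = 1"
        using k(2) cis_eq_1_iff_dvd[OF assms, of "k * (n div g)"] by (simp add: pow del: of_nat_mult)
      then have "n dvd n div g"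
        using primitive_rootsD[OF z] by blast
      then have "n div g = n"
        using assms by (metis dvd_div_eq_0_iff dvd_imp_le div_le_dividend le_antisym g_def gcd_dvd2
            neq0_conv)
      moreover have "g > 0" using assms by (simp add: g_def)
      ultimately have "g = 1"
        using assms by (metis div_less_dividend less_irrefl less_one linorder_neqE_nat)
      then have "k \<in> totatives n"
        using k False by (simp add: in_totatives_iff g_def coprime_iff_gcd_eq_1)
      with k show ?thesis by blast
    qed
  qed
qed

lemma finite_primitive_roots: "n > 0 \<Longrightarrow> finite (primitive_roots n)"
  using bij_betw_finite[OF bij_betw_primitive_roots] by simp

lemma card_primitive_roots: "n > 0 \<Longrightarrow> card (primitive_roots n) = totient n"
  using bij_betw_same_card[OF bij_betw_primitive_roots] by (simp add: totient_def)

lemma cyclotomic_eq_prod_primitive_roots: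
  assumes "n > 0"
  shows "cyclotomic n = (\<Prod>z\<in>primitive_roots n. [:- z, 1:])"
  unfolding cyclotomic_def
  by (rule prod.reindex_bij_betw[OF bij_betw_primitive_roots[OF assms]])

lemma degree_cyclotomic: "n > 0 \<Longrightarrow> degree (cyclotomic n) = totient n"
  by (simp add: cyclotomic_eq_prod_primitive_roots degree_prod_linear card_primitive_roots)

lemma lead_coeff_cyclotomic: "n > 0 \<Longrightarrow> lead_coeff (cyclotomic n) = 1"
  by (simp only: cyclotomic_eq_prod_primitive_roots lead_coeff_prod_linear)

lemma poly_cyclotomic_eq_0_iff: "n > 0 \<Longrightarrow> poly (cyclotomic n) z = 0 \<longleftrightarrow> z \<in> primitive_roots n"
  by (auto simp: cyclotomic_eq_prod_primitive_roots poly_prod finite_primitive_roots)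

lemma coeff_0_cyclotomic: "n > 0 \<Longrightarrow> coeff (cyclotomic n) 0 \<noteq> 0"
  by (auto simp: poly_0_coeff_0[symmetric] poly_cyclotomic_eq_0_iff primitive_roots_def
      power_0_left intro!: exI[of _ n])

lemma primitive_roots_power_coprime:
  assumes "z \<in> primitive_roots n" "coprime n p"
  shows "z ^ p \<in> primitive_roots n"
  using assms by (simp add: primitive_roots_def coprime_dvd_mult_right_iff flip: power_mult)

lemma primitive_roots_power_mult:
  assumes "z \<in> primitive_roots (n * p)" "p > 0"
  shows "z ^ p \<in> primitive_roots n"
  using assms by (simp add: primitive_roots_def mult.commute[of n] flip: power_mult)

lemma primitive_roots_disjoint:
  "m \<noteq> n \<Longrightarrow> primitive_roots m \<inter> primitive_roots n = {}"
  by (auto simp: primitive_roots_def) (metis dvd_antisym dvd_refl)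

text \<open>Exponents matter only modulo \<open>n\<close>, so raising to an inverse of
  \<open>p\<close> modulo \<open>n\<close> undoes the power map. For \<open>n = 0\<close>,
  coprimality forces \<open>p = 1\<close>.\<close>

lemma inj_on_power_primitive_roots:
  assumes "coprime n p"
  shows "inj_on (\<lambda>z. z ^ p) (primitive_roots n)"
proof (cases "n = 0")
  case True
  with assms show ?thesis by simp
next
  case False
  obtain q where q: "[p * q = 1] (mod n)"
    using cong_solve_coprime_nat[of p n] assms by (auto simp: coprime_commute)
  have inverse: "(z ^ p) ^ q = z" if "z \<in> primitive_roots n" for z
  proof -
    have z: "z ^ n = 1"
      using that by (simp add: primitive_rootsD)
    have power_mod: "z ^ k = z ^ (k mod n)" for k
      by (metis div_mult_mod_eq mult.commute mult_1 power_add power_mult power_one z)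
    show ?thesis
      using q power_mod[of "p * q"] power_mod[of 1] by (simp add: cong_def flip: power_mult)
  qed
  show ?thesis
    by (rule inj_on_inverseI[of _ "\<lambda>z. z ^ q"]) (rule inverse)
qed

text \<open>Elements of order \<open>n\<close> or \<open>n * p\<close> have a \<open>p\<close>-th
  power of order \<open>n\<close>. Since \<open>totient (n * p) = totient n * (p - 1)\<close>, there
  are as many of them as the degree of the right-hand side, so they are all its roots, each
  simple.\<close>

lemma cyclotomic_mult_prime:
  assumes "n > 0" "prime p" "\<not> p dvd n"
  shows "cyclotomic n * cyclotomic (n * p) = pcompose (cyclotomic n) (monom 1 p)"
proof -
  have p: "p > 1" "coprime n p"
    using assms prime_gt_1_nat prime_imp_coprime coprime_commute by blast+
  let ?A = "primitive_roots n" and ?B = "primitive_roots (n * p)"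
  have fin: "finite ?A" "finite ?B"
    using assms p by (auto intro!: finite_primitive_roots)
  have disj: "?A \<inter> ?B = {}"
    using assms p by (intro primitive_roots_disjoint) auto
  have "totient n + totient (n * p) = totient n * p"
    using assms p by (simp add: totient_mult_coprime totient_prime algebra_simps)
  then have card: "card (?A \<union> ?B) = totient n * p"
    using assms p disj fin by (simp add: card_Un_disjoint card_primitive_roots)
  have "pcompose (cyclotomic n) (monom 1 p) = (\<Prod>z\<in>?A \<union> ?B. [:- z, 1:])"
  proof (rule monic_eq_prod_linear)
    show "lead_coeff (pcompose (cyclotomic n) (monom 1 p)) = 1"
      using assms p lead_coeff_cyclotomic[of n]
      by (subst lead_coeff_comp) (auto simp: degree_monom_eq)
    show "degree (pcompose (cyclotomic n) (monom 1 p)) = card (?A \<union> ?B)"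
      using assms card by (simp add: degree_pcompose degree_monom_eq degree_cyclotomic)
    show "poly (pcompose (cyclotomic n) (monom 1 p)) z = 0" if "z \<in> ?A \<union> ?B" for z
      using that assms p primitive_roots_power_coprime primitive_roots_power_mult
      by (auto simp: poly_pcompose poly_monom poly_cyclotomic_eq_0_iff)
  qed (use fin in auto)
  also have "\<dots> = cyclotomic n * cyclotomic (n * p)"
    using assms p fin disj by (simp add: prod.union_disjoint cyclotomic_eq_prod_primitive_roots)
  finally show ?thesis by simp
qed

lemma degree_monom_minus_1:
  assumes "n > 0"
  shows "degree (monom 1 n - 1 :: complex poly) = n"
  using assms degree_add_eq_left[of "- 1" "monom 1 n :: complex poly"]
  by (simp add: degree_monom_eq)

lemma cyclotomic_dvd_unity:
  assumes "n > 0"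
  shows "cyclotomic n dvd monom 1 n - 1"
proof -
  have deg: "degree (monom 1 n - 1 :: complex poly) = n"
    using assms by (simp add: degree_monom_minus_1)
  have "monom 1 n - 1 = (\<Prod>z\<in>{z::complex. z ^ n = 1}. [:- z, 1:])"
  proof (rule monic_eq_prod_linear)
    show "lead_coeff (monom 1 n - 1 :: complex poly) = 1"
      using assms by (simp add: deg)
  qed (use assms deg in \<open>auto simp: finite_roots_unity card_roots_unity_eq poly_monom\<close>)
  moreover have "primitive_roots n \<subseteq> {z. z ^ n = 1}"
    by (auto simp: primitive_rootsD)
  ultimately show ?thesis
    using assms by (simp add: cyclotomic_eq_prod_primitive_roots prod_dvd_prod_subset finite_roots_unity)
qed

section \<open>The maximum gap\<close>

lemma gap_cyclotomic_le:
  assumes "n > 0" "prime p" "\<not> p dvd n" "g \<in> gaps (cyclotomic (n * p))"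
  shows "g \<le> totient n"
proof (rule ccontr)
  assume "\<not> g \<le> totient n"
  moreover obtain e e' where "g = e' - e" and e': "e' \<in> exponents (cyclotomic (n * p))"
    and empty: "exponents (cyclotomic (n * p)) \<inter> {e<..<e'} = {}"
    using assms(4) by (auto simp: gaps_def)
  ultimately have e: "coeff (cyclotomic (n * p)) e' \<noteq> 0" "e + totient n < e'"
    by (auto simp: exponents_def)
  have zero: "coeff (cyclotomic (n * p)) k = 0" if "e < k" "k < e'" for k
    using empty that by (auto simp: exponents_def)
  have p: "p > 0" "coprime n p"
    using assms prime_gt_0_nat prime_imp_coprime coprime_commute by blast+
  have np: "n * p > 0"
    using assms p by simp
  \<comment> \<open>The assumed gap supplies zeros from \<open>u = Suc e\<close> up to
    \<open>N - 1\<close>. \<open>T\<close> keeps the exponents whose \<open>p\<close>-fold lies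
    below \<open>N\<close>.\<close>
  define N where "N = Suc e + totient n"
  define T where "T = poly_cutoff (Suc ((N - 1) div p)) (cyclotomic n)"
  have "cyclotomic n * poly_cutoff (Suc e) (cyclotomic (n * p)) =
    poly_cutoff N (cyclotomic n * cyclotomic (n * p))"
    unfolding N_def using assms e zero
    by (intro poly_cutoff_mult_gap[symmetric]) (auto simp: degree_cyclotomic)
  also have "\<dots> = pcompose T (monom 1 p)"
    using assms p by (simp add: cyclotomic_mult_prime poly_cutoff_pcompose_monom T_def N_def)
  finally have T: "pcompose T (monom 1 p) =
    cyclotomic n * poly_cutoff (Suc e) (cyclotomic (n * p))" by simp
  have "poly T (z ^ p) = 0" if "z \<in> primitive_roots n" for z
    using that assms(1) arg_cong[OF T, of "\<lambda>f. poly f z"]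
    by (simp add: poly_pcompose poly_monom poly_cyclotomic_eq_0_iff)
  then have roots: "(\<lambda>z. z ^ p) ` primitive_roots n \<subseteq> {z. poly T z = 0}"
    by auto
  have "coeff T 0 \<noteq> 0"
    using assms by (simp add: T_def coeff_poly_cutoff coeff_0_cyclotomic)
  then have "T \<noteq> 0" by auto
  have "totient n = card ((\<lambda>z. z ^ p) ` primitive_roots n)"
    using assms p by (simp add: card_image inj_on_power_primitive_roots card_primitive_roots)
  also have "\<dots> \<le> card {z. poly T z = 0}"
    using \<open>T \<noteq> 0\<close> by (intro card_mono poly_roots_finite roots)
  also have "\<dots> \<le> degree T"
    using \<open>T \<noteq> 0\<close> by (rule card_poly_roots_bound)
  also have "\<dots> \<le> (N - 1) div p"
    by (rule degree_le) (simp add: T_def coeff_poly_cutoff)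
  \<comment> \<open>The truncation is proper: \<open>N - 1 = e + totient n\<close> lies below
    \<open>e'\<close>, which is at most the degree \<open>totient n * (p - 1)\<close>.\<close>
  also have "\<dots> < totient n"
  proof -
    have "e' \<le> totient (n * p)"
      using le_degree[OF e(1)] np by (simp only: degree_cyclotomic)
    also have "\<dots> = totient n * (p - 1)"
      using assms p by (simp add: totient_mult_coprime totient_prime)
    also have "\<dots> \<le> totient n * p" by simp
    finally have "N - 1 < totient n * p"
      using e(2) by (simp add: N_def)
    then show ?thesis
      using p by (simp add: less_mult_imp_div_less)
  qed
  finally show False by simp
qed

lemma totient_in_gaps_cyclotomic:
  assumes "n > 0" "prime p" "p > n"
  shows "totient n \<in> gaps (cyclotomic (n * p))"
proof -
  let ?a = "coeff (cyclotomic (n * p))" and ?b = "coeff (cyclotomic n) 0"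
  have ndvd: "\<not> p dvd n"
    using assms by (auto dest: dvd_imp_le)
  have np: "n * p > 0"
    using assms by simp
  obtain \<Psi> where \<Psi>: "monom 1 n - 1 = cyclotomic n * \<Psi>"
    using cyclotomic_dvd_unity[OF assms(1)] by blast
  have deg: "degree (monom 1 n - 1 :: complex poly) = n"
    using assms by (simp add: degree_monom_minus_1)
  then have nz: "cyclotomic n * \<Psi> \<noteq> 0"
    using assms(1) \<Psi> by (metis degree_0 less_irrefl)
  have "n = totient n + degree \<Psi>"
    using deg nz \<Psi> assms(1) by (metis degree_cyclotomic degree_mult_eq mult_eq_0_iff)
  then have deg_\<Psi>: "degree \<Psi> = n - totient n" by simp
  have eq: "(monom 1 n - 1) * cyclotomic (n * p) = pcompose (cyclotomic n) (monom 1 p) * \<Psi>"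
    using cyclotomic_mult_prime[OF assms(1,2) ndvd] \<Psi> by (simp add: mult_ac)
  \<comment> \<open>Below degree \<open>p\<close> only the constant term of the substituted
    polynomial contributes.\<close>
  have low: "coeff (pcompose (cyclotomic n) (monom 1 p) * \<Psi>) k = ?b * coeff \<Psi> k" if "k < p" for k
  proof -
    have "coeff (pcompose (cyclotomic n) (monom 1 p)) i = (if i = 0 then ?b else 0)" if "i < p" for i
      using that by (auto simp: coeff_pcompose_monom_power dvd_imp_le)
    then have "coeff (pcompose (cyclotomic n) (monom 1 p) * \<Psi>) k =
      (\<Sum>i\<le>k. if i = 0 then ?b * coeff \<Psi> k else 0)"
      unfolding coeff_mult using \<open>k < p\<close> by (intro sum.cong) auto
    then show ?thesis by simp
  qed
  \<comment> \<open>Below degree \<open>n\<close> the factor \<open>monom 1 n - 1\<close> acts as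
    multiplication by -1.\<close>
  have below: "?a k = - ?b * coeff \<Psi> k" if "k < n" for k
    using arg_cong[OF eq, of "\<lambda>f. coeff f k"] low[of k] that assms
    by (simp add: left_diff_distrib coeff_monom_mult) (metis minus_minus)
  have "coeff \<Psi> n = 0"
    using assms(1) deg_\<Psi> by (intro coeff_eq_0) (simp add: diff_less)
  \<comment> \<open>At degree \<open>n\<close> the left-hand side of \<open>eq\<close> has
    coefficient \<open>?a 0 - ?a n\<close>; the right-hand side has 0, by \<open>low\<close> with
    \<open>n < p\<close>.\<close>
  then have at_n: "?a n = ?a 0"
    using arg_cong[OF eq, of "\<lambda>f. coeff f n"] low[of n] assms
    by (simp add: left_diff_distrib coeff_monom_mult)
  have pos: "0 < totient n" "totient n \<le> n"
    using assms by (auto simp: totient_le)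
  have "coeff \<Psi> (n - totient n) \<noteq> 0"
    using nz deg_\<Psi> by (metis leading_coeff_0_iff mult_zero_right)
  then have "?a (n - totient n) \<noteq> 0"
    using below[of "n - totient n"] assms(1) pos coeff_0_cyclotomic[of n] by simp
  moreover have "?a n \<noteq> 0"
    using at_n coeff_0_cyclotomic[OF np] by simp
  moreover have "?a k = 0" if "n - totient n < k" "k < n" for k
    using below[of k] that deg_\<Psi> by (simp add: coeff_eq_0)
  ultimately have "n - (n - totient n) \<in> gaps (cyclotomic (n * p))"
    unfolding gaps_def exponents_def using pos
    by (intro CollectI exI[of _ "n - totient n"] exI[of _ n]) auto
  then show ?thesis
    using pos by simp
qed

theorem mainTheorem1:
  fixes m p :: nat
  assumes "squarefree m" and "odd m" and "m > 0" and "prime p" and "p > m"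
  shows "max_gap (cyclotomic (m * p)) = totient m"
proof -
  have "\<not> p dvd m"
    using assms by (auto dest: dvd_imp_le)
  then have le: "g \<le> totient m" if "g \<in> gaps (cyclotomic (m * p))" for g
    using that assms gap_cyclotomic_le by blast
  \<comment> \<open>\<open>Max\<close> is meaningful only on a finite set; the upper bound gives
    finiteness.\<close>
  then have "finite (gaps (cyclotomic (m * p)))"
    by (meson finite_nat_set_iff_bounded_le)
  then show ?thesis
    unfolding max_gap_def using le totient_in_gaps_cyclotomic assms by (intro Max_eqI) auto
qed

end
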